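(* In the simple game modeling the US legislative system, let $c_v(k)$ and $c_r(k)$ denote the number of coalitions of size $k$ in which the vice president, respectively a fixed representative, is critical. (a) If $c_v(k)=0$, then $c_r(k)=0$. (b) Suppose $k\in\mathbb{N}$ is such that $c_v(k)\ne0$, so that $270\le k\le 487$. If $270\le k\le 356$ or $380\le k\le 487$, then $c_v(k)>c_r(k)$. For the remaining $k$, i.e., $357\le k\le 379$, $c_r(k)>c_v(k)$.
   Context: The simple game modeling the US legislative system has 537 players: the president, the vice president, 100 senators and 435 representatives. The "full Senate" is the 101-element set consisting of the 100 senators and the vice president. The minimal winning coalitions are of two types: (I) the president, 51 members of the full Senate, and 218 representatives; (II) 67 senators (the vice president does not count here) and 290 representatives. A coalition (set of players) is winning iff it contains a coalition of type I or II. A player $i$ in a coalition $T$ is critical in $T$ if $T$ is winning and $T\setminus\{i\}$ is not. *)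

theory Defs
  imports Main
begin

text \<open>
  The senators are numbered from 0 to 99 and the representatives from 0 to 434; the type contains
  further values, so coalitions are required to be subsets of the set \<open>players\<close>.
\<close>

datatype player = President | VicePresident | Senator nat | Representative nat

definition senators :: "player set" where
  "senators = Senator ` {..<100}"

definition representatives :: "player set" where
  "representatives = Representative ` {..<435}"

definition full_senate :: "player set" where
  "full_senate = insert VicePresident senators"

definition players :: "player set" where
  "players = {President, VicePresident} \<union> senators \<union> representatives"

definition type_I :: "player set \<Rightarrow> bool" where
  "type_I M \<longleftrightarrow> (\<exists>F R. F \<subseteq> full_senate \<and> card F = 51 \<and>
     R \<subseteq> representatives \<and> card R = 218 \<and> M = {President} \<union> F \<union> R)"

definition type_II :: "player set \<Rightarrow> bool" where
  "type_II M \<longleftrightarrow> (\<exists>S R. S \<subseteq> senators \<and> card S = 67 \<and>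
     R \<subseteq> representatives \<and> card R = 290 \<and> M = S \<union> R)"

definition winning :: "player set \<Rightarrow> bool" where
  "winning T \<longleftrightarrow> T \<subseteq> players \<and> (\<exists>M \<subseteq> T. type_I M \<or> type_II M)"

definition critical :: "player \<Rightarrow> player set \<Rightarrow> bool" where
  "critical i T \<longleftrightarrow> i \<in> T \<and> winning T \<and> \<not> winning (T - {i})"

definition num_critical :: "player \<Rightarrow> nat \<Rightarrow> nat" where
  "num_critical i k = card {T. T \<subseteq> players \<and> card T = k \<and> critical i T}"

end

theory Submission imports Defs begin

text \<open>
  Counting coalitions by the numbers of senators and representatives they contain gives
  \<open>c\<^sub>v(k) = C(100, 50) C(435, k - 52)\<close> for \<open>k \<ge> 270\<close>, and
  \<open>c\<^sub>r(k) = C(434, 217) C(101, k - 219)\<close> for \<open>270 \<le> k \<le> 320\<close> (coalitions with the president),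
  \<open>c\<^sub>r(k) = C(434, 289) C(101, k - 290)\<close> for \<open>358 \<le> k \<le> 391\<close> (coalitions without), and
  \<open>c\<^sub>r(357) = C(434, 289) C(100, 67)\<close>: with only 67 members of the full Senate in a coalition
  without the president, the vice president has to be absent.
  Comparing the growth rates of the two sides as \<open>k\<close> increases by one, \<open>c\<^sub>r / c\<^sub>v\<close> decreases
  from 270 to 320, and it is unimodal on \<open>358 \<le> k \<le> 391\<close>; hence only the values at 270, 357, 358,
  379 and 380 have to be compared, and there common factors of the binomial coefficients cancel.
\<close>

section \<open>Counting coalitions by their chambers\<close>

text \<open>As \<open>D\<close>, \<open>X\<close>, \<open>Y\<close> are pairwise disjoint,
  \<open>T\<close> amounts to an independent choice of its traces on \<open>X\<close> and
  \<open>Y\<close>; \<open>D\<close> holds the forced members.\<close>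

lemma card_subsets_meeting_two_sets:
  assumes "finite D" "finite X" "finite Y" "D \<inter> X = {}" "D \<inter> Y = {}" "X \<inter> Y = {}"
  shows "card {T. D \<subseteq> T \<and> T \<subseteq> D \<union> X \<union> Y \<and> card (T \<inter> X) = a \<and> card (T \<inter> Y) = b}
    = (card X choose a) * (card Y choose b)"
proof -
  let ?A = "{A. A \<subseteq> X \<and> card A = a}" and ?B = "{B. B \<subseteq> Y \<and> card B = b}"
  have "bij_betw (\<lambda>(A, B). D \<union> A \<union> B) (?A \<times> ?B)
    {T. D \<subseteq> T \<and> T \<subseteq> D \<union> X \<union> Y \<and> card (T \<inter> X) = a \<and> card (T \<inter> Y) = b}"
  proof (rule bij_betw_byWitness[where f' = "\<lambda>T. (T \<inter> X, T \<inter> Y)"])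
    have inter: "(D \<union> A \<union> B) \<inter> X = A" "(D \<union> A \<union> B) \<inter> Y = B"
      if "A \<subseteq> X" "B \<subseteq> Y" for A B
      using that assms(4-6) by blast+
    show "\<forall>p\<in>?A \<times> ?B. (\<lambda>T. (T \<inter> X, T \<inter> Y)) (case p of (A, B) \<Rightarrow> D \<union> A \<union> B) = p"
      by (auto simp: inter)
    show "(\<lambda>(A, B). D \<union> A \<union> B) ` (?A \<times> ?B) \<subseteq>
      {T. D \<subseteq> T \<and> T \<subseteq> D \<union> X \<union> Y \<and> card (T \<inter> X) = a \<and> card (T \<inter> Y) = b}"
      by (auto simp: inter)
  qed auto
  then show ?thesis
    using bij_betw_same_card n_subsets[OF \<open>finite X\<close>, of a] n_subsets[OF \<open>finite Y\<close>, of b]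
    by (fastforce simp: card_cartesian_product)
qed

lemma finite_chambers [simp]:
  "finite senators" "finite representatives" "finite full_senate"
  by (auto simp: senators_def representatives_def full_senate_def)

lemma finite_players: "finite players"
  by (simp add: players_def)

lemma card_chambers [simp]:
  "card senators = 100" "card representatives = 435" "card full_senate = 101"
proof -
  show s: "card senators = 100" and "card representatives = 435"
    by (auto simp: senators_def representatives_def card_image inj_on_def)
  have "VicePresident \<notin> senators"
    by (auto simp: senators_def)
  then show "card full_senate = 101"
    using s by (simp add: full_senate_def)
qed

lemma players_disjoint:
  "President \<notin> full_senate" "President \<notin> representatives" "President \<notin> senators"
  "VicePresident \<notin> senators" "VicePresident \<notin> representatives"
  "senators \<inter> representatives = {}" "full_senate \<inter> representatives = {}"
  by (auto simp: senators_def representatives_def full_senate_def)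

lemma players_eq: "players = {President} \<union> full_senate \<union> representatives"
  by (auto simp: players_def full_senate_def)

section \<open>Winning and criticality as conditions on cardinalities\<close>

lemma ex_subset_card_iff:
  assumes "finite T"
  shows "(\<exists>F. F \<subseteq> A \<and> card F = n \<and> F \<subseteq> T) \<longleftrightarrow> n \<le> card (T \<inter> A)"
proof
  assume "\<exists>F. F \<subseteq> A \<and> card F = n \<and> F \<subseteq> T"
  then show "n \<le> card (T \<inter> A)"
    using assms by (metis Int_subset_iff card_mono finite_Int)
next
  assume "n \<le> card (T \<inter> A)"
  then obtain F where "F \<subseteq> T \<inter> A" "card F = n"
    by (rule obtain_subset_with_card_n)
  then show "\<exists>F. F \<subseteq> A \<and> card F = n \<and> F \<subseteq> T"
    by blast
qed

text \<open>The blocks of a minimal winning coalition can be chosen independently, so containing one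
  is a threshold condition on each chamber.\<close>

lemma winning_iff:
  assumes "T \<subseteq> players"
  shows "winning T \<longleftrightarrow>
    President \<in> T \<and> 51 \<le> card (T \<inter> full_senate) \<and> 218 \<le> card (T \<inter> representatives) \<or>
    67 \<le> card (T \<inter> senators) \<and> 290 \<le> card (T \<inter> representatives)"
proof -
  have fin: "finite T"
    using assms finite_players by (rule finite_subset)
  have "(\<exists>M\<subseteq>T. type_I M) \<longleftrightarrow> President \<in> T \<and>
      (\<exists>F. F \<subseteq> full_senate \<and> card F = 51 \<and> F \<subseteq> T) \<and>
      (\<exists>R. R \<subseteq> representatives \<and> card R = 218 \<and> R \<subseteq> T)"
  proof -
    have "(\<exists>M\<subseteq>T. type_I M) \<longleftrightarrow> (\<exists>F R. F \<subseteq> full_senate \<and> card F = 51 \<and>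
        R \<subseteq> representatives \<and> card R = 218 \<and> {President} \<union> F \<union> R \<subseteq> T)"
      unfolding type_I_def by metis
    then show ?thesis
      by (simp only: Un_subset_iff insert_subset empty_subsetI simp_thms) metis
  qed
  moreover have "(\<exists>M\<subseteq>T. type_II M) \<longleftrightarrow>
      (\<exists>S. S \<subseteq> senators \<and> card S = 67 \<and> S \<subseteq> T) \<and>
      (\<exists>R. R \<subseteq> representatives \<and> card R = 290 \<and> R \<subseteq> T)"
  proof -
    have "(\<exists>M\<subseteq>T. type_II M) \<longleftrightarrow> (\<exists>S R. S \<subseteq> senators \<and> card S = 67 \<and>
        R \<subseteq> representatives \<and> card R = 290 \<and> S \<union> R \<subseteq> T)"
      unfolding type_II_def by metis
    then show ?thesis
      by (simp only: Un_subset_iff) metis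
  qed
  ultimately show ?thesis
    using assms fin unfolding winning_def by (auto simp: ex_subset_card_iff)
qed

lemma card_Int_full_senate:
  "card (T \<inter> full_senate) = card (T \<inter> senators) + (if VicePresident \<in> T then 1 else 0)"
proof -
  have "T \<inter> full_senate =
      (if VicePresident \<in> T then insert VicePresident (T \<inter> senators) else T \<inter> senators)"
    by (auto simp: full_senate_def)
  then show ?thesis
    using players_disjoint(4) by simp
qed

lemma card_coalition:
  assumes "T \<subseteq> players"
  shows "card T = (if President \<in> T then 1 else 0) + card (T \<inter> full_senate)
    + card (T \<inter> representatives)"
proof -
  have "T = (T \<inter> {President}) \<union> (T \<inter> full_senate) \<union> (T \<inter> representatives)"
    using assms by (auto simp: players_eq)
  then have "card T = card ((T \<inter> {President}) \<union> (T \<inter> full_senate) \<union> (T \<inter> representatives))"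
    by simp
  also have "\<dots> = card (T \<inter> {President}) + card (T \<inter> full_senate) + card (T \<inter> representatives)"
    using players_disjoint by (subst card_Un_disjoint; (subst card_Un_disjoint)?; auto)
  finally show ?thesis
    by simp
qed

text \<open>Type II ignores the vice president, so the only way to lose is to fall from 51 to 50
  members of the full Senate; 50 senators rule out type II.\<close>

lemma critical_VicePresident_iff:
  assumes "T \<subseteq> players"
  shows "critical VicePresident T \<longleftrightarrow> VicePresident \<in> T \<and> President \<in> T \<and>
    card (T \<inter> senators) = 50 \<and> 218 \<le> card (T \<inter> representatives)"
proof -
  have sub: "T - {VicePresident} \<subseteq> players"
    using assms by blast
  have "(T - {VicePresident}) \<inter> senators = T \<inter> senators"
    "(T - {VicePresident}) \<inter> representatives = T \<inter> representatives"
    using players_disjoint by blast+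
  note eqs = this
  show ?thesis
    unfolding critical_def winning_iff[OF assms] winning_iff[OF sub] card_Int_full_senate eqs
    by auto
qed

text \<open>If the president is in \<open>T\<close>, a coalition meeting the type II thresholds
  still satisfies type I with 289 representatives. Hence 290 can be the critical number only in the
  president's absence.\<close>

lemma critical_representative_iff:
  assumes "T \<subseteq> players" "r \<in> representatives"
  shows "critical r T \<longleftrightarrow> r \<in> T \<and>
    (President \<in> T \<and> 51 \<le> card (T \<inter> full_senate) \<and> card (T \<inter> representatives) = 218 \<or>
     President \<notin> T \<and> 67 \<le> card (T \<inter> senators) \<and> card (T \<inter> representatives) = 290)"
proof (cases "r \<in> T")
  case True
  have sub: "T - {r} \<subseteq> players"
    using assms by blast
  have eqs: "(T - {r}) \<inter> senators = T \<inter> senators" "(T - {r}) \<inter> full_senate = T \<inter> full_senate"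
    "President \<in> T - {r} \<longleftrightarrow> President \<in> T"
    using players_disjoint assms(2) by blast+
  have card_R: "card ((T - {r}) \<inter> representatives) = card (T \<inter> representatives) - 1"
    using True assms(2) by (simp add: Diff_Int_distrib2)
  have "card (T \<inter> senators) \<le> card (T \<inter> full_senate)"
    by (simp add: card_Int_full_senate)
  then show ?thesis
    using True
    unfolding critical_def winning_iff[OF assms(1)] winning_iff[OF sub] eqs card_R
    by auto
qed (simp add: critical_def)

section \<open>Closed formulas for the two counts\<close>

text \<open>President, vice president and 50 senators leave \<open>k - 52\<close> representatives,
  and \<open>218 \<le> k - 52\<close> means \<open>270 \<le> k\<close>. Beyond 487 the binomial
  coefficient vanishes by itself.\<close>

lemma num_critical_VicePresident:
  "num_critical VicePresident k =
    (if 270 \<le> k then (100 choose 50) * (435 choose (k - 52)) else 0)"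
proof -
  let ?C = "{T. T \<subseteq> players \<and> card T = k \<and> critical VicePresident T}"
  show ?thesis
  proof (cases "270 \<le> k")
    case True
    have "?C = {T. {President, VicePresident} \<subseteq> T \<and>
        T \<subseteq> {President, VicePresident} \<union> senators \<union> representatives \<and>
        card (T \<inter> senators) = 50 \<and> card (T \<inter> representatives) = k - 52}"
      unfolding players_def[symmetric] using True
      by (auto simp: critical_VicePresident_iff card_coalition card_Int_full_senate)
    moreover have "card \<dots> = (card senators choose 50) * (card representatives choose (k - 52))"
      using players_disjoint by (intro card_subsets_meeting_two_sets) auto
    ultimately show ?thesis
      using True by (simp only: num_critical_def card_chambers if_True)
  next
    case False
    then have "?C = {}"
      by (auto simp: critical_VicePresident_iff card_coalition card_Int_full_senate)
    then show ?thesis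
      using False by (simp only: num_critical_def) simp
  qed
qed

text \<open>The summands count coalitions with and without the president. The remaining 217 or 289
  representatives come from 434; the size then fixes the number of full Senate members.\<close>

lemma num_critical_representative:
  assumes r: "r \<in> representatives"
  shows "num_critical r k =
    (if 270 \<le> k then (434 choose 217) * (101 choose (k - 219)) else 0) +
    (if 358 \<le> k then (434 choose 289) * (101 choose (k - 290))
     else if k = 357 then (434 choose 289) * (100 choose 67) else 0)"
proof -
  let ?R = "representatives - {r}"
  let ?C1 = "{T. T \<subseteq> players \<and> card T = k \<and> r \<in> T \<and> President \<in> T \<and>
    51 \<le> card (T \<inter> full_senate) \<and> card (T \<inter> representatives) = 218}"
  let ?C2 = "{T. T \<subseteq> players \<and> card T = k \<and> r \<in> T \<and> President \<notin> T \<and>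
    67 \<le> card (T \<inter> senators) \<and> card (T \<inter> representatives) = 290}"
  have r': "r \<noteq> President" "r \<noteq> VicePresident" "r \<notin> senators" "r \<notin> full_senate"
    using r players_disjoint by auto
  have cR: "card ?R = 434"
    using r by simp
  have cT: "card (T \<inter> representatives) = Suc (card (T \<inter> ?R))" if "r \<in> T" for T
  proof -
    have "T \<inter> representatives = insert r (T \<inter> ?R)"
      using that r by blast
    then show ?thesis
      by simp
  qed
  have "{T. T \<subseteq> players \<and> card T = k \<and> critical r T} = ?C1 \<union> ?C2"
    using r by (auto simp: critical_representative_iff)
  moreover have "finite ?C1" "finite ?C2"
    using finite_players by simp_all
  moreover have "?C1 \<inter> ?C2 = {}"
    by blast
  ultimately have "num_critical r k = card ?C1 + card ?C2"
    by (simp only: num_critical_def card_Un_disjoint)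
  moreover have "card ?C1 = (if 270 \<le> k then (434 choose 217) * (101 choose (k - 219)) else 0)"
  proof (cases "270 \<le> k")
    case True
    have pl: "players = {President, r} \<union> full_senate \<union> ?R"
      using r by (auto simp: players_eq)
    have "?C1 = {T. {President, r} \<subseteq> T \<and> T \<subseteq> {President, r} \<union> full_senate \<union> ?R \<and>
        card (T \<inter> full_senate) = k - 219 \<and> card (T \<inter> ?R) = 217}"
      unfolding pl[symmetric] using True by (auto simp: card_coalition cT)
    moreover have "card \<dots> = (card full_senate choose (k - 219)) * (card ?R choose 217)"
      using players_disjoint r r' by (intro card_subsets_meeting_two_sets) auto
    ultimately show ?thesis
      using True by (simp only: cR card_chambers if_True mult.commute)
  next
    case False
    then have "?C1 = {}"
      by (auto simp: card_coalition)
    then show ?thesis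
      using False by (simp only:) simp
  qed
  moreover have "card ?C2 =
    (if 358 \<le> k then (434 choose 289) * (101 choose (k - 290))
     else if k = 357 then (434 choose 289) * (100 choose 67) else 0)"
  proof -
    consider "358 \<le> k" | "k = 357" | "k < 357"
      by linarith
    then show ?thesis
    proof cases
      case 1
      have pl: "T \<subseteq> {r} \<union> full_senate \<union> ?R \<longleftrightarrow> T \<subseteq> players \<and> President \<notin> T" for T
        using r r' players_disjoint by (auto simp: players_eq)
      \<comment> \<open>At least 68 members of the full Senate include at least 67 senators, so the
        vice president may be present or absent.\<close>
      have "?C2 = {T. {r} \<subseteq> T \<and> T \<subseteq> {r} \<union> full_senate \<union> ?R \<and>
          card (T \<inter> full_senate) = k - 290 \<and> card (T \<inter> ?R) = 289}"
        unfolding pl using 1 by (auto simp: card_coalition cT card_Int_full_senate split: if_splits)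
      moreover have "card \<dots> = (card full_senate choose (k - 290)) * (card ?R choose 289)"
        using players_disjoint r r' by (intro card_subsets_meeting_two_sets) auto
      ultimately show ?thesis
        using 1 by (simp only: cR card_chambers if_True mult.commute)
    next
      case 2
      have pl: "T \<subseteq> {r} \<union> senators \<union> ?R \<longleftrightarrow>
          T \<subseteq> players \<and> President \<notin> T \<and> VicePresident \<notin> T" for T
        using r r' players_disjoint by (auto simp: players_def)
      have "?C2 = {T. {r} \<subseteq> T \<and> T \<subseteq> {r} \<union> senators \<union> ?R \<and>
          card (T \<inter> senators) = 67 \<and> card (T \<inter> ?R) = 289}"
        unfolding pl using 2 by (auto simp: card_coalition cT card_Int_full_senate split: if_splits)
      moreover have "card \<dots> = (card senators choose 67) * (card ?R choose 289)"
        using players_disjoint r r' by (intro card_subsets_meeting_two_sets) auto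
      ultimately show ?thesis
        using 2 by (simp only: cR card_chambers mult.commute) simp
    next
      case 3
      then have "?C2 = {}"
        by (auto simp: card_coalition card_Int_full_senate)
      then show ?thesis
        using 3 by (simp only:) simp
    qed
  qed
  ultimately show ?thesis
    by simp
qed

section \<open>Ratios of binomial coefficients without division\<close>

text \<open>This is the growth rate along a row of Pascal's triangle; truncated subtraction makes it
  hold for \<open>n \<le> k\<close> too.\<close>

lemma Suc_times_binomial_Suc: "Suc k * (n choose Suc k) = (n - k) * (n choose k)"
proof (cases n)
  case (Suc m)
  then show ?thesis
    using Suc_times_binomial[of k m] binomial_absorb_comp[of n k] by simp
qed simp

lemma prod_times_binomial_add:
  "(\<Prod>i<j. Suc (k + i)) * (n choose (k + j)) = (\<Prod>i<j. n - k - i) * (n choose k)"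
proof (induction j)
  case (Suc j)
  have "(\<Prod>i<Suc j. Suc (k + i)) * (n choose (k + Suc j))
      = (\<Prod>i<j. Suc (k + i)) * (Suc (k + j) * (n choose Suc (k + j)))"
    by (simp only: prod.lessThan_Suc add_Suc_right mult_ac)
  also have "\<dots> = (n - k - j) * ((\<Prod>i<j. Suc (k + i)) * (n choose (k + j)))"
    by (simp only: Suc_times_binomial_Suc diff_diff_left mult_ac)
  also have "\<dots> = (n - k - j) * ((\<Prod>i<j. n - k - i) * (n choose k))"
    by (simp only: Suc.IH)
  also have "\<dots> = (\<Prod>i<Suc j. n - k - i) * (n choose k)"
    by (simp only: prod.lessThan_Suc mult_ac)
  finally show ?case .
qed simp

lemma prod_lessThan_numeral:
  "prod f {..<numeral n} = prod f {..<pred_numeral n} * f (pred_numeral n)"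
  by (simp add: numeral_eq_Suc)

text \<open>\<open>q / p\<close> and \<open>q' / p'\<close> are the growth factors from
  \<open>a\<close> to \<open>a'\<close> and from \<open>b\<close> to \<open>b'\<close>. The smaller
  number grows by at most the other's factor, and \<open>0 < q'\<close> keeps the inequality
  strict.\<close>

lemma less_of_ratio_le:
  fixes a b a' b' :: nat
  assumes "p * a' = q * a" "p' * b' = q' * b" "q * p' \<le> q' * p" "a < b" "0 < p" "0 < p'" "0 < q'"
  shows "a' < b'"
proof -
  have "p * p' * a' = q * p' * a"
    using assms(1) by (metis mult.assoc mult.commute)
  also have "\<dots> \<le> q' * p * a"
    using assms(3) by (rule mult_le_mono1)
  also have "\<dots> < q' * p * b"
    using assms(4,5,7) by simp
  also have "\<dots> = p * p' * b'"
    using assms(2) by (metis mult.assoc mult.commute)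
  finally show ?thesis
    by simp
qed

text \<open>The conclusion says \<open>w / x < y / z\<close>, where the quotients equal
  \<open>q / p\<close> and \<open>q' / p'\<close>. Only these ratios need evaluation, not the large
  coefficients.\<close>

lemma mult_less_mult_of_ratios:
  fixes x y z w :: nat
  assumes "p * w = q * x" "p' * y = q' * z" "q * p' < q' * p" "0 < x" "0 < z"
  shows "z * w < x * y"
proof -
  have "p * p' * (z * w) = (p * w) * (p' * z)"
    by (simp only: mult_ac)
  also have "\<dots> = q * p' * (x * z)"
    by (simp only: assms(1) mult_ac)
  also have "\<dots> < q' * p * (x * z)"
    using assms(3-5) by simp
  also have "\<dots> = (p' * y) * (p * x)"
    by (simp only: assms(2) mult_ac)
  also have "\<dots> = p * p' * (x * y)"
    by (simp only: mult_ac)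
  finally show ?thesis
    by simp
qed

section \<open>Comparison with the coalitions containing the president\<close>

text \<open>Here the coalition size is \<open>k = 270 + j\<close>.\<close>

lemma representative_less_VicePresident_small:
  "j \<le> 217 \<Longrightarrow> ((434::nat) choose 217) * (101 choose (51 + j))
    < (100 choose 50) * (435 choose (218 + j))"
proof (induction j)
  case 0
  \<comment> \<open>At \<open>k = 270\<close> the claim reduces to
    \<open>101 / 51 < 435 / 218\<close>.\<close>
  have "51 * ((101::nat) choose 51) = 101 * (100 choose 50)"
    using Suc_times_binomial[of 50 100] by simp
  moreover have "218 * ((435::nat) choose 218) = 435 * (434 choose 217)"
    using Suc_times_binomial[of 217 434] by simp
  ultimately show ?case
    unfolding add_0_right by (rule mult_less_mult_of_ratios) simp_all
next
  case (Suc j)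
  let ?a = "\<lambda>j. ((434::nat) choose 217) * (101 choose (51 + j))"
  let ?b = "\<lambda>j. ((100::nat) choose 50) * (435 choose (218 + j))"
  have a: "Suc (51 + j) * ?a (Suc j) = (101 - (51 + j)) * ?a j"
    using Suc_times_binomial_Suc[of "51 + j" 101] by (metis add_Suc_right mult.left_commute)
  have b: "Suc (218 + j) * ?b (Suc j) = (435 - (218 + j)) * ?b j"
    using Suc_times_binomial_Suc[of "218 + j" 435] by (metis add_Suc_right mult.left_commute)
  have "(101 - (51 + j)) * Suc (218 + j) \<le> (435 - (218 + j)) * Suc (51 + j)"
  proof (cases "j \<le> 50")
    case True
    \<comment> \<open>Writing \<open>m\<close> for \<open>50 - j\<close> removes the truncated
      subtractions; the products \<open>m * j\<close> then cancel and a linear inequality remains.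
      For larger \<open>j\<close> the left side is 0.\<close>
    then obtain m where m: "50 = j + m"
      using le_Suc_ex by blast
    have "101 - (51 + j) = m" "435 - (218 + j) = 167 + m" "m \<le> 50"
      using m by simp_all
    then show ?thesis
      by (simp add: algebra_simps)
  qed simp
  then show ?case
    using Suc by (intro less_of_ratio_le[OF a b]) simp_all
qed

section \<open>Comparison with the coalitions lacking the president\<close>

text \<open>One step from row \<open>n\<close> to row \<open>Suc n\<close>, then \<open>j\<close>
  steps along that row: this links rows 434 and 435, and rows 100 and 101.\<close>

lemma prod_times_binomial_Suc_add:
  "((Suc n - k) * (\<Prod>i<j. Suc (k + i))) * (Suc n choose (k + j))
    = (Suc n * (\<Prod>i<j. Suc n - k - i)) * (n choose k)"
proof -
  have "((Suc n - k) * (\<Prod>i<j. Suc (k + i))) * (Suc n choose (k + j))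
      = (\<Prod>i<j. Suc n - k - i) * ((Suc n - k) * (Suc n choose k))"
    by (simp only: mult.assoc prod_times_binomial_add) (simp only: mult_ac)
  also have "\<dots> = (Suc n * (\<Prod>i<j. Suc n - k - i)) * (n choose k)"
    by (simp only: binomial_absorb_comp diff_Suc_1) (simp only: mult_ac)
  finally show ?thesis .
qed

text \<open>Coefficients are paired across the products, by chamber: \<open>435 choose 305\<close>
  with \<open>434 choose 289\<close>, and \<open>100 choose 67\<close> with
  \<open>100 choose 50\<close>.\<close>

lemma VicePresident_less_representative_357:
  "((100::nat) choose 50) * (435 choose 305) < (434 choose 289) * (100 choose 67)"
  using mult_less_mult_of_ratios[OF
    prod_times_binomial_Suc_add[of 434 289 16] prod_times_binomial_add[of 50 17 100]]
  by (simp add: prod_lessThan_numeral)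

lemma VicePresident_less_representative_358:
  "((100::nat) choose 50) * (435 choose 306) < (434 choose 289) * (101 choose 68)"
  using mult_less_mult_of_ratios[OF
    prod_times_binomial_Suc_add[of 434 289 17] prod_times_binomial_Suc_add[of 100 50 18]]
  by (simp add: prod_lessThan_numeral)

lemma VicePresident_less_representative_379:
  "((100::nat) choose 50) * (435 choose 327) < (434 choose 289) * (101 choose 89)"
  using mult_less_mult_of_ratios[OF
    prod_times_binomial_Suc_add[of 434 289 38] prod_times_binomial_Suc_add[of 100 50 39]]
  by (simp add: prod_lessThan_numeral)

lemma representative_less_VicePresident_380:
  "((434::nat) choose 289) * (101 choose 90) < (100 choose 50) * (435 choose 328)"
  using mult_less_mult_of_ratios[OF
    prod_times_binomial_Suc_add[of 100 50 40] prod_times_binomial_Suc_add[of 434 289 39]]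
  by (simp add: prod_lessThan_numeral)

text \<open>\<open>v j\<close> and \<open>q j\<close> are \<open>c\<^sub>v(k)\<close> and \<open>c\<^sub>r(k)\<close> for \<open>k = 358 + j\<close>.\<close>

context
  fixes v q :: "nat \<Rightarrow> nat"
  defines "v \<equiv> \<lambda>j. (100 choose 50) * (435 choose (306 + j))"
    and "q \<equiv> \<lambda>j. (434 choose 289) * (101 choose (68 + j))"
begin

private lemma v_Suc: "Suc (306 + j) * v (Suc j) = (435 - (306 + j)) * v j"
  using Suc_times_binomial_Suc[of "306 + j" 435] unfolding v_def
  by (metis add_Suc_right mult.left_commute)

private lemma q_Suc: "Suc (68 + j) * q (Suc j) = (101 - (68 + j)) * q j"
  using Suc_times_binomial_Suc[of "68 + j" 101] unfolding q_def
  by (metis add_Suc_right mult.left_commute)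

text \<open>Cross-multiplied, the growth rates of \<open>v\<close> and \<open>q\<close> differ by a
  multiple of \<open>334 * j - 1230\<close>, which changes sign between 3 and 4.\<close>

private lemma growth_rates:
  "j \<le> 3 \<Longrightarrow> (435 - (306 + j)) * Suc (68 + j) \<le> (101 - (68 + j)) * Suc (306 + j)"
  "4 \<le> j \<Longrightarrow> j < 129 \<Longrightarrow> (101 - (68 + j)) * Suc (306 + j) \<le> (435 - (306 + j)) * Suc (68 + j)"
proof -
  show "(435 - (306 + j)) * Suc (68 + j) \<le> (101 - (68 + j)) * Suc (306 + j)" if "j \<le> 3"
  proof -
    have "j = 0 \<or> j = 1 \<or> j = 2 \<or> j = 3"
      using that by linarith
    then show ?thesis
      by auto
  qed
  show "(101 - (68 + j)) * Suc (306 + j) \<le> (435 - (306 + j)) * Suc (68 + j)"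
    if "4 \<le> j" "j < 129"
  proof (cases "j \<le> 33")
    case True
    then obtain m where m: "33 = j + m"
      using le_Suc_ex by blast
    have "101 - (68 + j) = m" "435 - (306 + j) = 96 + m" "m \<le> 29" "j = 33 - m"
      using m that by simp_all
    then show ?thesis
      by (simp add: algebra_simps)
  qed simp
qed

text \<open>The quotient \<open>q / v\<close> first rises, then falls, so the ends
  \<open>j = 0\<close> and \<open>j = 21\<close> decide: induction runs upwards from 0 to 3 and
  downwards from 21 to 4.\<close>

lemma VicePresident_less_representative_middle: "j \<le> 21 \<Longrightarrow> v j < q j"
proof (cases "j \<le> 3")
  case True
  then show ?thesis
  proof (induction j)
    case 0
    then show ?case
      using VicePresident_less_representative_358 by (simp add: v_def q_def)
  next
    case (Suc j)
    then show ?case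
      using growth_rates(1)[of j] by (intro less_of_ratio_le[OF v_Suc q_Suc]) simp_all
  qed
next
  case False
  assume "j \<le> 21"
  then show ?thesis
    using False
  proof (induction rule: inc_induct)
    case base
    then show ?case
      using VicePresident_less_representative_379 by (simp add: v_def q_def)
  next
    case (step j)
    \<comment> \<open>The recurrences read backwards turn the claim for \<open>Suc j\<close> into
      the claim for \<open>j\<close>.\<close>
    then show ?case
      using growth_rates(2)[of j]
      by (intro less_of_ratio_le[OF v_Suc[of j, symmetric] q_Suc[of j, symmetric]])
        (simp_all add: mult.commute)
  qed
qed

text \<open>Past the crossing, the inequality at size 380 propagates upwards. The bound
  \<open>129 = 435 - 306\<close> keeps the growth factor of \<open>v\<close> positive in each
  step.\<close>

lemma representative_less_VicePresident_large: "22 \<le> j \<Longrightarrow> j \<le> 129 \<Longrightarrow> q j < v j"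
proof (induction rule: dec_induct)
  case base
  then show ?case
    using representative_less_VicePresident_380 by (simp add: v_def q_def)
next
  case (step j)
  then show ?case
    using growth_rates(2)[of j] by (intro less_of_ratio_le[OF q_Suc v_Suc]) simp_all
qed

end

theorem proposition8:
  fixes r :: player
  assumes "r \<in> representatives"
  shows "(\<forall>k. num_critical VicePresident k = 0 \<longrightarrow> num_critical r k = 0) \<and>
    (\<forall>k. num_critical VicePresident k \<noteq> 0 \<longrightarrow>
      (270 \<le> k \<and> k \<le> 487) \<and>
      ((270 \<le> k \<and> k \<le> 356) \<or> (380 \<le> k \<and> k \<le> 487) \<longrightarrow>
        num_critical VicePresident k > num_critical r k) \<and>
      (357 \<le> k \<and> k \<le> 379 \<longrightarrow>
        num_critical r k > num_critical VicePresident k))"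
proof (intro conjI allI impI)
  let ?v = "num_critical VicePresident" and ?r = "num_critical r"
  note counts = num_critical_VicePresident num_critical_representative[OF assms]
  show "?r k = 0" if "?v k = 0" for k
  proof -
    \<comment> \<open>For \<open>487 < k\<close> both \<open>k - 219\<close> and
      \<open>k - 290\<close> exceed 101, so both summands of \<open>?r k\<close> vanish.\<close>
    have "k < 270 \<or> 487 < k"
      using that by (auto simp: num_critical_VicePresident split: if_splits)
    then show ?thesis
      by (auto simp: counts)
  qed
  fix k
  assume "?v k \<noteq> 0"
  then show k: "270 \<le> k" "k \<le> 487"
    by (auto simp: num_critical_VicePresident split: if_splits)
  show "?v k > ?r k" if "(270 \<le> k \<and> k \<le> 356) \<or> (380 \<le> k \<and> k \<le> 487)"
  proof (cases "k \<le> 356")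
    case True
    obtain j where "k = 270 + j"
      using k le_Suc_ex by blast
    then show ?thesis
      using True representative_less_VicePresident_small[of j] by (simp add: counts)
  next
    case False
    have "358 \<le> k"
      using that False by linarith
    then obtain j where "k = 358 + j"
      using le_Suc_ex by blast
    \<comment> \<open>Here \<open>k - 219\<close> exceeds 101, so the summand with the president is
      0.\<close>
    then show ?thesis
      using that k representative_less_VicePresident_large[of j] by (auto simp: counts binomial_eq_0)
  qed
  show "?r k > ?v k" if "357 \<le> k \<and> k \<le> 379"
  proof (cases "k = 357")
    case True
    then show ?thesis
      using VicePresident_less_representative_357 by (simp add: counts binomial_eq_0)
  next
    case False
    have "358 \<le> k"
      using that False by linarith
    then obtain j where "k = 358 + j"
      using le_Suc_ex by blast
    then show ?thesis
      using that VicePresident_less_representative_middle[of j] by (simp add: counts binomial_eq_0)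
  qed
qed

end
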